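(* For every integer $n\geq 4$ with $n\notin\{6,7\}$, $\chi_{td}(H_n)=\chi_{td}(W_n)$. Moreover $\chi_{td}(H_6)=\chi_{td}(H_7)=8$, and these are exceptions to the equality, i.e. $\chi_{td}(H_n)\neq\chi_{td}(W_n)$ for $n\in\{6,7\}$.
   Context: Graphs are finite, simple and undirected. For $n\geq 4$, the wheel $W_n$ is the graph on $n$ vertices obtained from the cycle $C_{n-1}$ on $n-1$ vertices (the outer circuit) by adding one vertex adjacent to all vertices of the cycle. The helm $H_n$ is obtained from $W_n$ by appending one leaf to each vertex of the outer circuit. A total labeling of a graph $G$ is a function $f:V(G)\cup E(G)\to\mathbb{Z}^+$ (positive integers) such that $f(u)\neq f(v)$ for adjacent vertices $u,v$; $f(\{u,v\})\neq f(\{v,w\})$ for any two distinct incident edges $\{u,v\},\{v,w\}$; and $f(u)\neq f(\{u,v\})$ for every edge $\{u,v\}$ and incident vertex $u$. It is a $k$-total labeling if the maximum label assigned to any vertex or edge is $k$. A $k$-total difference labeling is a $k$-total labeling $f$ with $f(\{u,v\})=|f(u)-f(v)|$ for every edge $\{u,v\}$. The total difference chromatic number $\chi_{td}(G)$ is the smallest integer $k$ for which $G$ has a $k$-total difference labeling. *)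

theory Defs
  imports Main
begin

record 'a ugraph =
  verts :: "'a set"
  edges :: "'a set set"

definition simple_graph :: "'a ugraph \<Rightarrow> bool" where
  "simple_graph G \<longleftrightarrow> finite (verts G) \<and> (\<forall>e\<in>edges G. e \<subseteq> verts G \<and> card e = 2)"

definition cycle_graph :: "nat \<Rightarrow> nat ugraph" where
  "cycle_graph m = \<lparr>verts = {..<m}, edges = {{i, (i + 1) mod m} | i. i < m}\<rparr>"

datatype helm_vertex = Hub | Rim nat | Leaf nat

text \<open>The index \<open>n\<close> is the number of vertices of the wheel, so the outer circuit is the
  cycle on \<open>n - 1\<close> vertices; both definitions are only meant for \<open>n \<ge> 4\<close>.\<close>

definition wheel :: "nat \<Rightarrow> helm_vertex ugraph" where
  "wheel n = (let C = cycle_graph (n - 1) in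
     \<lparr>verts = insert Hub (Rim ` verts C),
      edges = ((`) Rim) ` edges C \<union> {{Hub, Rim i} | i. i \<in> verts C}\<rparr>)"

definition helm :: "nat \<Rightarrow> helm_vertex ugraph" where
  "helm n = (let C = cycle_graph (n - 1); W = wheel n in
     \<lparr>verts = verts W \<union> Leaf ` verts C,
      edges = edges W \<union> {{Rim i, Leaf i} | i. i \<in> verts C}\<rparr>)"

text \<open>A labeling of \<open>V(G) \<union> E(G)\<close> is a function on the disjoint sum: \<open>Inl v\<close> is the
  vertex \<open>v\<close> and \<open>Inr e\<close> is the edge \<open>e\<close>. Values outside \<open>V(G) \<union> E(G)\<close> are irrelevant.\<close>

definition total_labeling :: "'a ugraph \<Rightarrow> ('a + 'a set \<Rightarrow> nat) \<Rightarrow> bool" where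
  "total_labeling G f \<longleftrightarrow>
     (\<forall>x \<in> verts G <+> edges G. f x > 0) \<and>
     (\<forall>u v. {u, v} \<in> edges G \<longrightarrow> f (Inl u) \<noteq> f (Inl v)) \<and>
     (\<forall>u v w. {u, v} \<in> edges G \<and> {v, w} \<in> edges G \<and> {u, v} \<noteq> {v, w}
        \<longrightarrow> f (Inr {u, v}) \<noteq> f (Inr {v, w})) \<and>
     (\<forall>u v. {u, v} \<in> edges G \<longrightarrow> f (Inl u) \<noteq> f (Inr {u, v}))"

definition k_total_labeling :: "nat \<Rightarrow> 'a ugraph \<Rightarrow> ('a + 'a set \<Rightarrow> nat) \<Rightarrow> bool" where
  "k_total_labeling k G f \<longleftrightarrow> total_labeling G f \<and> Max (f ` (verts G <+> edges G)) = k"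

definition k_total_difference_labeling ::
    "nat \<Rightarrow> 'a ugraph \<Rightarrow> ('a + 'a set \<Rightarrow> nat) \<Rightarrow> bool" where
  "k_total_difference_labeling k G f \<longleftrightarrow> k_total_labeling k G f \<and>
     (\<forall>u v. {u, v} \<in> edges G \<longrightarrow> int (f (Inr {u, v})) = \<bar>int (f (Inl u)) - int (f (Inl v))\<bar>)"

text \<open>\<open>LEAST\<close> is only meaningful if some \<open>k\<close> qualifies; lemma
  \<open>total_difference_labeling_exists\<close> below shows that this is so for every simple graph.\<close>

definition total_difference_chromatic_number :: "'a ugraph \<Rightarrow> nat"  ("\<chi>td") where
  "\<chi>td G = (LEAST k. \<exists>f. k_total_difference_labeling k G f)"

lemma simple_graph_wheel:
  assumes "n \<ge> 4"
  shows "simple_graph (wheel n)" and "card (verts (wheel n)) = n"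
proof -
  have "i \<noteq> Suc i mod (n - 1) \<and> Suc i mod (n - 1) < n - 1" if "i < n - 1" for i
    using that assms by (cases "Suc i = n - 1") auto
  then show "simple_graph (wheel n)"
    by (auto simp: simple_graph_def wheel_def cycle_graph_def Let_def)
  have "card (verts (wheel n)) = Suc (card (Rim ` {..<n - 1}))"
    unfolding wheel_def cycle_graph_def Let_def by (simp add: card_insert_if image_iff)
  then show "card (verts (wheel n)) = n"
    using assms by (simp add: card_image inj_on_def)
qed

lemma simple_graph_helm:
  assumes "n \<ge> 4"
  shows "simple_graph (helm n)"
proof -
  have "Rim i \<in> verts (wheel n)" if "i \<in> verts (cycle_graph (n - 1))" for i
    using that by (simp add: wheel_def Let_def)
  moreover have "finite (verts (cycle_graph (n - 1)))"
    by (simp add: cycle_graph_def)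
  ultimately show ?thesis
    using simple_graph_wheel(1)[OF assms] by (auto simp: simple_graph_def helm_def Let_def)
qed

text \<open>Label the vertices by distinct powers of \<open>3\<close>.\<close>

lemma total_difference_labeling_exists:
  assumes "simple_graph G"
  shows "\<exists>k f. k_total_difference_labeling k G f"
proof -
  obtain h :: "'a \<Rightarrow> nat" where h: "inj_on h (verts G)"
    using assms finite_imp_inj_to_nat_seg unfolding simple_graph_def by metis
  define p :: "'a \<Rightarrow> int" where "p v = 3 ^ h v" for v
  define d :: "'a set \<Rightarrow> nat" where
    "d e = (THE m. \<exists>u v. e = {u, v} \<and> int m = \<bar>p u - p v\<bar>)" for e
  define f where "f = case_sum (\<lambda>v. nat (p v)) d"
  have p0: "p v > 0" for v by (simp add: p_def)
  have d: "int (d {u, v}) = \<bar>p u - p v\<bar>" for u v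
  proof -
    have "d {u, v} = nat \<bar>p u - p v\<bar>"
      unfolding d_def by (rule the_equality) (auto simp: doubleton_eq_iff abs_minus_commute)
    then show ?thesis by simp
  qed
  have E: "u \<in> verts G \<and> v \<in> verts G \<and> u \<noteq> v" if "{u, v} \<in> edges G" for u v
    using that assms unfolding simple_graph_def by (force simp: card_2_iff)
  have lt: "3 * p u \<le> p v" if "h u < h v" for u v
    unfolding p_def using power_increasing[of "Suc (h u)" "h v" "3::int"] that by simp
  have tri: "3 * p u \<le> p v \<or> 3 * p v \<le> p u" if "u \<in> verts G" "v \<in> verts G" "u \<noteq> v" for u v
    using lt[of u v] lt[of v u] inj_onD[OF h, of u v] that by force
  have adj: "f (Inl u) \<noteq> f (Inl v)" "d {u, v} > 0" "f (Inl u) \<noteq> d {u, v}"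
    if "{u, v} \<in> edges G" for u v
    using tri[of u v] E[OF that] p0[of u] p0[of v] d[of u v] by (auto simp: f_def)
  have inc: "d {u, v} \<noteq> d {v, w}"
    if "{u, v} \<in> edges G" "{v, w} \<in> edges G" "{u, v} \<noteq> {v, w}" for u v w
  proof -
    have "u \<noteq> w" using that(3) by (auto simp: insert_commute)
    then show ?thesis
      using tri[of u v] tri[of v w] tri[of u w] E[OF that(1)] E[OF that(2)]
        p0[of u] p0[of v] p0[of w] d[of u v] d[of v w] by linarith
  qed
  have pos: "f x > 0" if "x \<in> verts G <+> edges G" for x
  proof (cases x)
    case (Inl v)
    then show ?thesis using p0 by (simp add: f_def)
  next
    case (Inr e)
    then have e: "e \<in> edges G" using that by auto
    then obtain u v where "e = {u, v}"
      using assms unfolding simple_graph_def by (auto simp: card_2_iff)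
    then show ?thesis using adj(2)[of u v] e Inr by (simp add: f_def)
  qed
  have "total_labeling G f"
    unfolding total_labeling_def using pos adj inc by (auto simp: f_def)
  then have "k_total_difference_labeling (Max (f ` (verts G <+> edges G))) G f"
    unfolding k_total_difference_labeling_def k_total_labeling_def
    using d p0 by (auto simp: f_def less_imp_le)
  then show ?thesis by blast
qed

end

theory Submission
  imports Defs
begin

text \<open>
  Edge labels are determined by vertex labels, so \<open>\<chi>td G \<le> k\<close> means that the vertices can be
  labeled by \<open>1, \<dots>, k\<close> with adjacent labels distinct and neither double the other, and with
  \<open>g u \<noteq> g w\<close> and \<open>g u + g w \<noteq> 2 * g v\<close> on every path \<open>u, v, w\<close>. Such a labeling of the helm
  restricts to the wheel. Conversely, given a labeling of the wheel, only nine values are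
  forbidden at each leaf, so it extends to the helm when \<open>k \<ge> 10\<close>; and \<open>k \<ge> n\<close> always, because
  the hub forces all labels of the wheel to be distinct. The orders \<open>n < 10\<close> are settled by
  explicit labelings and a finite search.
\<close>

section \<open>Reduction from total difference labelings to vertex labels\<close>

text \<open>Since \<open>{u, v} = {v, u}\<close>, quantifying over all ordered pairs makes the
  doubling condition symmetric, so one direction is written.\<close>

definition vertex_labels :: "'a ugraph \<Rightarrow> nat \<Rightarrow> ('a \<Rightarrow> nat) \<Rightarrow> bool" where
  "vertex_labels G k g \<longleftrightarrow>
     (\<forall>v\<in>verts G. g v \<in> {1..k}) \<and>
     (\<forall>u v. {u, v} \<in> edges G \<longrightarrow> g u \<noteq> g v \<and> g u \<noteq> 2 * g v) \<and>
     (\<forall>u v w. {u, v} \<in> edges G \<and> {v, w} \<in> edges G \<and> u \<noteq> w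
        \<longrightarrow> g u \<noteq> g w \<and> g u + g w \<noteq> 2 * g v)"

text \<open>For positive labels, \<open>x = |x - y|\<close> means \<open>y = 2 * x\<close>, so
  vertex and edge labels clash exactly on doubling. Likewise \<open>|x - y| = |y - z|\<close> means
  \<open>x = z\<close> or \<open>x + z = 2 * y\<close>, so incident edges clash exactly on equal
  ends or an arithmetic progression.\<close>

lemma vertex_labels_if_difference_labeling:
  assumes G: "simple_graph G" and f: "k_total_difference_labeling k G f"
  shows "vertex_labels G k (\<lambda>v. f (Inl v))"
proof -
  let ?X = "verts G <+> edges G"
  have "edges G \<subseteq> Pow (verts G)" and "finite (verts G)"
    using G by (auto simp: simple_graph_def)
  then have fin: "finite ?X"
    by (meson finite_Plus finite_Pow_iff finite_subset)
  have T: "total_labeling G f" and k: "Max (f ` ?X) = k"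
    and d: "\<And>u v. {u, v} \<in> edges G \<Longrightarrow> int (f (Inr {u, v})) = \<bar>int (f (Inl u)) - int (f (Inl v))\<bar>"
    using f by (auto simp: k_total_difference_labeling_def k_total_labeling_def)
  have "f (Inl v) \<in> {1..k}" if "v \<in> verts G" for v
  proof -
    have "f (Inl v) \<in> f ` ?X" using that by auto
    then have "f (Inl v) \<le> k"
      unfolding k[symmetric] by (rule Max_ge[OF finite_imageI[OF fin]])
    then show ?thesis using T that by (auto simp: total_labeling_def Suc_le_eq)
  qed
  moreover have "f (Inl u) \<noteq> f (Inl v) \<and> f (Inl u) \<noteq> 2 * f (Inl v)" if e: "{u, v} \<in> edges G" for u v
  proof -
    have "{v, u} \<in> edges G" using e by (simp add: insert_commute)
    then have "f (Inl u) \<noteq> f (Inl v)" "f (Inl v) \<noteq> f (Inr {v, u})"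
      using T e unfolding total_labeling_def by blast+
    then show ?thesis using d[OF \<open>{v, u} \<in> edges G\<close>] by linarith
  qed
  moreover have "f (Inl u) \<noteq> f (Inl w) \<and> f (Inl u) + f (Inl w) \<noteq> 2 * f (Inl v)"
    if e: "{u, v} \<in> edges G" "{v, w} \<in> edges G" and "u \<noteq> w" for u v w
  proof -
    have "{u, v} \<noteq> {v, w}" using \<open>u \<noteq> w\<close> by (auto simp: doubleton_eq_iff)
    then have "f (Inr {u, v}) \<noteq> f (Inr {v, w})"
      using T e unfolding total_labeling_def by blast
    then show ?thesis using d[OF e(1)] d[OF e(2)] by linarith
  qed
  ultimately show ?thesis unfolding vertex_labels_def by blast
qed

text \<open>The labels \<open>1, ..., k\<close> need not all occur, so the maximum attained is only
  some \<open>j \<le> k\<close>; for bounding a minimum this suffices.\<close>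

lemma difference_labeling_if_vertex_labels:
  assumes G: "simple_graph G" "verts G \<noteq> {}" and g: "vertex_labels G k g"
  shows "\<exists>j\<le>k. \<exists>f. k_total_difference_labeling j G f"
proof -
  let ?X = "verts G <+> edges G"
  \<comment> \<open>On an edge, maximum minus minimum is the absolute difference of the two end
    labels, without a choice of orientation.\<close>
  define f where "f = case_sum g (\<lambda>e. Max (g ` e) - Min (g ` e))"
  have "edges G \<subseteq> Pow (verts G)" and "finite (verts G)"
    using G by (auto simp: simple_graph_def)
  then have fin: "finite ?X"
    by (meson finite_Plus finite_Pow_iff finite_subset)
  have d: "int (f (Inr {u, v})) = \<bar>int (g u) - int (g v)\<bar>" for u v
    by (simp add: f_def)
  have v: "g v \<in> {1..k}" if "v \<in> verts G" for v
    using g that by (simp add: vertex_labels_def)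
  have e: "u \<in> verts G" "v \<in> verts G" "g u \<noteq> g v" "g u \<noteq> 2 * g v" "g v \<noteq> 2 * g u"
    if "{u, v} \<in> edges G" for u v
  proof -
    have "{v, u} \<in> edges G" using that by (simp add: insert_commute)
    then show "g u \<noteq> g v" "g u \<noteq> 2 * g v" "g v \<noteq> 2 * g u"
      using g that unfolding vertex_labels_def by blast+
    show "u \<in> verts G" "v \<in> verts G" using G(1) that by (auto simp: simple_graph_def)
  qed
  have edge: "f (Inl u) \<noteq> f (Inl v) \<and> f (Inl u) \<noteq> f (Inr {u, v}) \<and> f (Inr {u, v}) \<in> {1..k}"
    if "{u, v} \<in> edges G" for u v
    using e[OF that] v[of u] v[of v] d[of u v] by (auto simp: f_def)
  have inc: "f (Inr {u, v}) \<noteq> f (Inr {v, w})"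
    if "{u, v} \<in> edges G" "{v, w} \<in> edges G" "{u, v} \<noteq> {v, w}" for u v w
  proof -
    have "u \<noteq> w" using that(3) by (auto simp: insert_commute)
    then have "g u \<noteq> g w" "g u + g w \<noteq> 2 * g v"
      using g that unfolding vertex_labels_def by blast+
    then show ?thesis using d[of u v] d[of v w] by linarith
  qed
  have range: "f x \<in> {1..k}" if "x \<in> ?X" for x
  proof (cases x)
    case (Inl a)
    then show ?thesis using v that by (auto simp: f_def)
  next
    case (Inr a)
    then have a: "a \<in> edges G" using that by auto
    then obtain u w where "a = {u, w}"
      using G(1) unfolding simple_graph_def by (auto simp: card_2_iff)
    then show ?thesis using edge a Inr by blast
  qed
  have "total_labeling G f"
    unfolding total_labeling_def using range edge inc by force
  then have "k_total_difference_labeling (Max (f ` ?X)) G f"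
    unfolding k_total_difference_labeling_def k_total_labeling_def
    using d by (auto simp: f_def)
  moreover have "Max (f ` ?X) \<le> k"
    using fin G(2) range by (subst Max_le_iff) auto
  ultimately show ?thesis by blast
qed

lemma chromatic_number_le_iff:
  assumes "simple_graph G" "verts G \<noteq> {}"
  shows "\<chi>td G \<le> k \<longleftrightarrow> (\<exists>g. vertex_labels G k g)"
proof
  assume le: "\<chi>td G \<le> k"
  have "\<exists>f. k_total_difference_labeling (\<chi>td G) G f"
    unfolding total_difference_chromatic_number_def
    by (rule LeastI_ex) (rule total_difference_labeling_exists[OF assms(1)])
  then obtain f where "k_total_difference_labeling (\<chi>td G) G f" by blast
  then have "vertex_labels G (\<chi>td G) (\<lambda>v. f (Inl v))"
    using assms(1) by (rule vertex_labels_if_difference_labeling[rotated])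
  then have "vertex_labels G k (\<lambda>v. f (Inl v))"
    using le by (fastforce simp: vertex_labels_def)
  then show "\<exists>g. vertex_labels G k g" by blast
next
  assume "\<exists>g. vertex_labels G k g"
  then obtain j f where "j \<le> k" "k_total_difference_labeling j G f"
    using difference_labeling_if_vertex_labels assms by blast
  moreover from this have "\<chi>td G \<le> j"
    unfolding total_difference_chromatic_number_def by (intro Least_le) blast
  ultimately show "\<chi>td G \<le> k" by simp
qed

section \<open>Rim neighbors and the edges of wheel and helm\<close>

definition nxt :: "nat \<Rightarrow> nat \<Rightarrow> nat" where
  "nxt m i = Suc i mod m"

text \<open>Adding \<open>m\<close> before subtracting keeps natural subtraction from truncating at
  \<open>i = 0\<close>.\<close>

definition prv :: "nat \<Rightarrow> nat \<Rightarrow> nat" where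
  "prv m i = (i + m - 1) mod m"

lemma nxt_eq: "i < m \<Longrightarrow> nxt m i = (if Suc i = m then 0 else Suc i)"
  by (auto simp: nxt_def)

lemma prv_eq: "i < m \<Longrightarrow> prv m i = (if i = 0 then m - 1 else i - 1)"
  by (cases i) (auto simp: prv_def)

lemma nxt_eq_iff: "i < m \<Longrightarrow> j < m \<Longrightarrow> nxt m j = i \<longleftrightarrow> j = prv m i"
  by (auto simp: nxt_eq prv_eq)

lemma nxt_prv_less [simp]: "i < m \<Longrightarrow> nxt m i < m" "i < m \<Longrightarrow> prv m i < m"
  by (auto simp: nxt_def prv_def)

lemma verts_wheel: "verts (wheel n) = insert Hub (Rim ` {..<n - 1})"
  by (simp add: wheel_def cycle_graph_def Let_def)

lemma verts_helm: "verts (helm n) = verts (wheel n) \<union> Leaf ` {..<n - 1}"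
  by (simp add: helm_def cycle_graph_def Let_def)

text \<open>The singletons are there because \<open>{u, v}\<close> collapses to one when a case
  analysis identifies its two ends.\<close>

lemma edges_wheel:
  "{Hub} \<notin> edges (wheel n)"
  "{Leaf i} \<notin> edges (wheel n)"
  "{Hub, Rim i} \<in> edges (wheel n) \<longleftrightarrow> i < n - 1"
  "{Rim i, Hub} \<in> edges (wheel n) \<longleftrightarrow> i < n - 1"
  "{Leaf i, u} \<notin> edges (wheel n)"
  "{u, Leaf i} \<notin> edges (wheel n)"
  by (auto simp: wheel_def cycle_graph_def Let_def doubleton_eq_iff)

lemma edges_wheel_rim:
  "{Rim i, Rim j} \<in> edges (wheel n) \<longleftrightarrow> i < n - 1 \<and> j < n - 1 \<and> (j = nxt (n - 1) i \<or> j = prv (n - 1) i)"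
proof -
  let ?m = "n - 1"
  have "(`) Rim ` edges (cycle_graph ?m) = {{Rim l, Rim (nxt ?m l)} | l. l < ?m}"
    by (simp add: cycle_graph_def nxt_def setcompr_eq_image image_image)
  then have "edges (wheel n) =
      {{Rim l, Rim (nxt ?m l)} | l. l < ?m} \<union> {{Hub, Rim l} | l. l \<in> verts (cycle_graph ?m)}"
    unfolding wheel_def Let_def by simp
  then have "{Rim i, Rim j} \<in> edges (wheel n) \<longleftrightarrow>
      (\<exists>l<?m. {Rim i, Rim j} = {Rim l, Rim (nxt ?m l)})"
    by (auto simp: doubleton_eq_iff)
  also have "\<dots> \<longleftrightarrow> i < ?m \<and> j < ?m \<and> (j = nxt ?m i \<or> i = nxt ?m j)"
    using nxt_prv_less(1) unfolding doubleton_eq_iff helm_vertex.inject by metis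
  finally show ?thesis using nxt_eq_iff by metis
qed

lemma edges_helm:
  "{u, v} \<in> edges (helm n) \<longleftrightarrow> {u, v} \<in> edges (wheel n) \<or>
     (\<exists>i<n - 1. u = Rim i \<and> v = Leaf i \<or> u = Leaf i \<and> v = Rim i)"
  by (auto simp: helm_def cycle_graph_def Let_def doubleton_eq_iff)

section \<open>Labelings in terms of hub, rim and leaves\<close>

text \<open>Here \<open>a\<close> and \<open>b\<close> label adjacent rim vertices and
  \<open>h\<close> the hub. The sums come from the paths hub, \<open>b\<close>, \<open>a\<close> and
  hub, \<open>a\<close>, \<open>b\<close>; distinctness is left to
  \<open>wheel_labels\<close>.\<close>

definition step_ok :: "nat \<Rightarrow> nat \<Rightarrow> nat \<Rightarrow> bool" where
  "step_ok h a b \<longleftrightarrow> a \<noteq> 2 * b \<and> b \<noteq> 2 * a \<and> h + a \<noteq> 2 * b \<and> h + b \<noteq> 2 * a"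

lemma step_ok_commute: "step_ok h a b \<longleftrightarrow> step_ok h b a"
  unfolding step_ok_def by blast

text \<open>After the range of \<open>h\<close>, the lines collect the conditions from the spokes,
  from the paths centered at the hub (which join any two rim vertices), and from the rim edges and
  the paths centered on the rim.\<close>

definition wheel_labels :: "nat \<Rightarrow> nat \<Rightarrow> nat \<Rightarrow> (nat \<Rightarrow> nat) \<Rightarrow> bool" where
  "wheel_labels m k h r \<longleftrightarrow> h \<in> {1..k} \<and>
     (\<forall>i<m. r i \<in> {1..k} \<and> r i \<noteq> h \<and> r i \<noteq> 2 * h \<and> h \<noteq> 2 * r i) \<and>
     (\<forall>i<m. \<forall>j<m. i \<noteq> j \<longrightarrow> r i \<noteq> r j \<and> r i + r j \<noteq> 2 * h) \<and>
     (\<forall>i<m. step_ok h (r i) (r (nxt m i)) \<and> r (prv m i) + r (nxt m i) \<noteq> 2 * r i)"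

text \<open>The leaf hangs at the rim vertex labeled \<open>b\<close>, whose rim neighbors are labeled \<open>a\<close> and \<open>c\<close>.\<close>

definition leaf_label :: "nat \<Rightarrow> nat \<Rightarrow> nat \<Rightarrow> nat \<Rightarrow> nat \<Rightarrow> bool" where
  "leaf_label h a b c l \<longleftrightarrow> l \<noteq> b \<and> l \<noteq> 2 * b \<and> b \<noteq> 2 * l \<and>
     l \<noteq> a \<and> l \<noteq> c \<and> l \<noteq> h \<and> l + a \<noteq> 2 * b \<and> l + c \<noteq> 2 * b \<and> l + h \<noteq> 2 * b"

lemma vertex_labels_wheel:
  assumes "n \<ge> 4"
  shows "vertex_labels (wheel n) k g \<longleftrightarrow> wheel_labels (n - 1) k (g Hub) (\<lambda>i. g (Rim i))"
proof
  let ?m = "n - 1"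
  \<comment> \<open>The last claim rests on the rim having at least three vertices: the two rim
    neighbors differ, so they are the ends of a genuine path.\<close>
  have E: "{Rim i, Rim (nxt ?m i)} \<in> edges (wheel n)" "{Rim (nxt ?m i), Rim i} \<in> edges (wheel n)"
    "{Rim (prv ?m i), Rim i} \<in> edges (wheel n)" "{Hub, Rim i} \<in> edges (wheel n)"
    "{Rim i, Hub} \<in> edges (wheel n)" "prv ?m i \<noteq> nxt ?m i" if "i < ?m" for i
    using that assms nxt_eq_iff[of "nxt ?m i" ?m i] nxt_eq_iff[of "i" ?m "prv ?m i"]
    by (auto simp: edges_wheel edges_wheel_rim nxt_eq prv_eq split: if_splits)
  assume L: "vertex_labels (wheel n) k g"
  have L1: "g u \<noteq> g v \<and> g u \<noteq> 2 * g v" if "{u, v} \<in> edges (wheel n)" for u v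
    using L that unfolding vertex_labels_def by blast
  have L2: "g u \<noteq> g w \<and> g u + g w \<noteq> 2 * g v"
    if "{u, v} \<in> edges (wheel n)" "{v, w} \<in> edges (wheel n)" "u \<noteq> w" for u v w
    using L that unfolding vertex_labels_def by blast
  show "wheel_labels ?m k (g Hub) (\<lambda>i. g (Rim i))"
    unfolding wheel_labels_def step_ok_def
  proof (intro conjI allI impI)
    show "g Hub \<in> {1..k}" using L by (simp add: vertex_labels_def verts_wheel)
  next
    fix i assume i: "i < ?m"
    show "g (Rim i) \<in> {1..k}" using L i by (simp add: vertex_labels_def verts_wheel)
    show "g (Rim i) \<noteq> g Hub" "g (Rim i) \<noteq> 2 * g Hub" "g Hub \<noteq> 2 * g (Rim i)"
      using L1 E(4,5)[OF i] by blast+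
    show "g (Rim i) \<noteq> 2 * g (Rim (nxt ?m i))" "g (Rim (nxt ?m i)) \<noteq> 2 * g (Rim i)"
      using L1 E(1,2)[OF i] by blast+
    show "g Hub + g (Rim i) \<noteq> 2 * g (Rim (nxt ?m i))"
      using L2[OF E(4) E(2)] i by simp
    show "g Hub + g (Rim (nxt ?m i)) \<noteq> 2 * g (Rim i)"
      using L2[OF E(4) E(1)] i by simp
    show "g (Rim (prv ?m i)) + g (Rim (nxt ?m i)) \<noteq> 2 * g (Rim i)"
      using L2[OF E(3) E(1)] E(6) i by simp
  next
    fix i j assume "i < ?m" "j < ?m" "i \<noteq> j"
    then show "g (Rim i) \<noteq> g (Rim j)" "g (Rim i) + g (Rim j) \<noteq> 2 * g Hub"
      using L2[OF E(5) E(4)] by auto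
  qed
next
  let ?m = "n - 1"
  assume W: "wheel_labels ?m k (g Hub) (\<lambda>i. g (Rim i))"
  have R: "g (Rim i) \<noteq> g Hub" "g (Rim i) \<noteq> 2 * g Hub" "g Hub \<noteq> 2 * g (Rim i)"
    if "i < ?m" for i
    using W that by (auto simp: wheel_labels_def)
  have D: "g (Rim i) \<noteq> g (Rim j)" "g (Rim i) + g (Rim j) \<noteq> 2 * g Hub"
    if "i < ?m" "j < ?m" "i \<noteq> j" for i j
    using W that by (auto simp: wheel_labels_def)
  have S: "step_ok (g Hub) (g (Rim i)) (g (Rim j))" "i \<noteq> j"
    if "{Rim i, Rim j} \<in> edges (wheel n)" for i j
  proof -
    have *: "i < ?m" "j < ?m" "j = nxt ?m i \<or> i = nxt ?m j"
      using that nxt_eq_iff[of i ?m j] by (auto simp: edges_wheel_rim)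
    have "step_ok (g Hub) (g (Rim l)) (g (Rim (nxt ?m l)))" if "l < ?m" for l
      using W that unfolding wheel_labels_def by blast
    then show "step_ok (g Hub) (g (Rim i)) (g (Rim j))"
      using * step_ok_commute by metis
    have "nxt ?m l \<noteq> l" if "l < ?m" for l
      using that assms by (auto simp: nxt_eq)
    then show "i \<noteq> j" using * by metis
  qed
  have S': "g (Rim i) \<noteq> 2 * g (Rim j)" "g Hub + g (Rim i) \<noteq> 2 * g (Rim j)" "i < ?m" "j < ?m"
    if "{Rim i, Rim j} \<in> edges (wheel n)" for i j
    using S(1)[OF that] that unfolding step_ok_def edges_wheel_rim by blast+
  have T: "g (Rim i) + g (Rim j) \<noteq> 2 * g (Rim a)"
    if "{Rim i, Rim a} \<in> edges (wheel n)" "{Rim a, Rim j} \<in> edges (wheel n)" "i \<noteq> j" for i a j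
  proof -
    have "{Rim a, Rim i} \<in> edges (wheel n)" using that(1) by (simp add: insert_commute)
    then have "a < ?m" "{i, j} = {prv ?m a, nxt ?m a}"
      using that(2,3) by (auto simp: edges_wheel_rim)
    moreover from this have "g (Rim (prv ?m a)) + g (Rim (nxt ?m a)) \<noteq> 2 * g (Rim a)"
      using W unfolding wheel_labels_def by blast
    ultimately show ?thesis by (auto simp: doubleton_eq_iff add.commute)
  qed
  show "vertex_labels (wheel n) k g"
    unfolding vertex_labels_def
  proof (intro conjI allI impI ballI)
    fix v assume "v \<in> verts (wheel n)"
    then show "g v \<in> {1..k}" using W by (auto simp: verts_wheel wheel_labels_def)
  next
    fix u v assume "{u, v} \<in> edges (wheel n)"
    then consider i where "u = Hub" "v = Rim i" "i < ?m" | i where "u = Rim i" "v = Hub" "i < ?m"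
      | i j where "u = Rim i" "v = Rim j" "{Rim i, Rim j} \<in> edges (wheel n)"
      by (cases u; cases v) (auto simp: edges_wheel)
    then have "g u \<noteq> g v \<and> g u \<noteq> 2 * g v"
    proof cases
      case 1
      then show ?thesis using R[of i] by simp
    next
      case 2
      then show ?thesis using R[of i] by simp
    next
      case 3
      then show ?thesis using D(1)[of i j] S(2)[of i j] S'[of i j] by simp
    qed
    then show "g u \<noteq> g v" "g u \<noteq> 2 * g v" by auto
  next
    fix u v w assume "{u, v} \<in> edges (wheel n) \<and> {v, w} \<in> edges (wheel n) \<and> u \<noteq> w"
    \<comment> \<open>Paths are sorted by the position of the hub: middle, first, last, or
      absent.\<close>
    then consider i j where "u = Rim i" "v = Hub" "w = Rim j" "i < ?m" "j < ?m" "i \<noteq> j"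
      | i j where "u = Hub" "v = Rim i" "w = Rim j" "{Rim j, Rim i} \<in> edges (wheel n)"
      | i j where "u = Rim j" "v = Rim i" "w = Hub" "{Rim j, Rim i} \<in> edges (wheel n)"
      | i a j where "u = Rim i" "v = Rim a" "w = Rim j"
          "{Rim i, Rim a} \<in> edges (wheel n)" "{Rim a, Rim j} \<in> edges (wheel n)" "i \<noteq> j"
      by (cases u; cases v; cases w) (auto simp: edges_wheel insert_commute)
    then have "g u \<noteq> g w \<and> g u + g w \<noteq> 2 * g v"
    proof cases
      case 1
      then show ?thesis using D[of i j] by simp
    next
      case 2
      then show ?thesis using R(1)[of j] S'[of j i] by auto
    next
      case 3
      then show ?thesis using R(1)[of j] S'[of j i] by (simp add: add.commute)
    next
      case 4
      then show ?thesis using D(1)[of i j] S'(3)[of i a] S'(4)[of a j] T[of i a j] by simp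
    qed
    then show "g u \<noteq> g w" "g u + g w \<noteq> 2 * g v" by auto
  qed
qed

text \<open>A leaf has degree one, so it is never the middle of a path. Each new path runs from a
  leaf through its rim vertex to the hub or to one of two rim neighbors, and
  \<open>leaf_label\<close> lists these three cases after the new edge.\<close>

lemma vertex_labels_helm:
  assumes "n \<ge> 4"
  shows "vertex_labels (helm n) k g \<longleftrightarrow> vertex_labels (wheel n) k g \<and>
    (\<forall>i<n - 1. g (Leaf i) \<in> {1..k} \<and>
      leaf_label (g Hub) (g (Rim (prv (n - 1) i))) (g (Rim i)) (g (Rim (nxt (n - 1) i))) (g (Leaf i)))"
    (is "?H \<longleftrightarrow> ?W \<and> ?L")
proof (intro iffI conjI allI impI)
  assume H: ?H
  then show ?W unfolding vertex_labels_def edges_helm verts_helm by blast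
  fix i assume i: "i < n - 1"
  let ?a = "Rim (prv (n - 1) i)" and ?c = "Rim (nxt (n - 1) i)"
  have e: "{Rim i, Leaf i} \<in> edges (helm n)" "{Leaf i, Rim i} \<in> edges (helm n)"
    "{Rim i, ?a} \<in> edges (helm n)" "{Rim i, ?c} \<in> edges (helm n)" "{Rim i, Hub} \<in> edges (helm n)"
    using i by (auto simp: edges_helm edges_wheel edges_wheel_rim)
  have L: "g (Leaf i) \<noteq> g w" "g (Leaf i) + g w \<noteq> 2 * g (Rim i)"
    if "{Rim i, w} \<in> edges (helm n)" "w \<noteq> Leaf i" for w
    using H e(2) that unfolding vertex_labels_def by blast+
  have "g (Leaf i) \<noteq> g (Rim i)" "g (Leaf i) \<noteq> 2 * g (Rim i)" "g (Rim i) \<noteq> 2 * g (Leaf i)"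
    using H e(1,2) unfolding vertex_labels_def by blast+
  then show "leaf_label (g Hub) (g ?a) (g (Rim i)) (g ?c) (g (Leaf i))"
    using L[OF e(3)] L[OF e(4)] L[OF e(5)] by (simp add: leaf_label_def)
  show "g (Leaf i) \<in> {1..k}"
    using H i by (simp add: vertex_labels_def verts_helm)
next
  assume "?W \<and> ?L"
  then have W: ?W and L: ?L by auto
  have W1: "g u \<noteq> g v \<and> g u \<noteq> 2 * g v" if "{u, v} \<in> edges (wheel n)" for u v
    using W that unfolding vertex_labels_def by blast
  have W2: "g u \<noteq> g w \<and> g u + g w \<noteq> 2 * g v"
    if "{u, v} \<in> edges (wheel n)" "{v, w} \<in> edges (wheel n)" "u \<noteq> w" for u v w
    using W that unfolding vertex_labels_def by blast
  have N: "g (Leaf i) \<noteq> g w \<and> g (Leaf i) + g w \<noteq> 2 * g (Rim i)"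
    if "i < n - 1" "{Rim i, w} \<in> edges (wheel n)" for i w
    using L that by (cases w) (auto simp: edges_wheel edges_wheel_rim leaf_label_def)
  have N': "g w \<noteq> g (Leaf i) \<and> g w + g (Leaf i) \<noteq> 2 * g (Rim i)"
    if "i < n - 1" "{w, Rim i} \<in> edges (wheel n)" for i w
    using N[of i w] that by (auto simp: insert_commute add.commute)
  show ?H
    unfolding vertex_labels_def
  proof (intro conjI allI impI ballI)
    fix v assume "v \<in> verts (helm n)"
    then show "g v \<in> {1..k}" using W L by (auto simp: vertex_labels_def verts_helm leaf_label_def)
  next
    fix u v assume "{u, v} \<in> edges (helm n)"
    then show "g u \<noteq> g v" "g u \<noteq> 2 * g v"
      using W1 L by (auto simp: edges_helm leaf_label_def)
  next
    fix u v w assume "{u, v} \<in> edges (helm n) \<and> {v, w} \<in> edges (helm n) \<and> u \<noteq> w"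
    then show "g u \<noteq> g w" "g u + g w \<noteq> 2 * g v"
      using W2 N N' by (auto simp: edges_helm edges_wheel)
  qed
qed

lemma chromatic_number_wheel_le_iff:
  assumes "n \<ge> 4"
  shows "\<chi>td (wheel n) \<le> k \<longleftrightarrow> (\<exists>h r. wheel_labels (n - 1) k h r)"
proof -
  have "(\<exists>g. wheel_labels (n - 1) k (g Hub) (\<lambda>i. g (Rim i))) \<longleftrightarrow> (\<exists>h r. wheel_labels (n - 1) k h r)"
  proof
    assume "\<exists>h r. wheel_labels (n - 1) k h r"
    then obtain h r where "wheel_labels (n - 1) k h r" by blast
    then show "\<exists>g. wheel_labels (n - 1) k (g Hub) (\<lambda>i. g (Rim i))"
      \<comment> \<open>Leaves lie outside the wheel; the second \<open>r\<close> is an arbitrary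
        filler for them.\<close>
      by (intro exI[of _ "case_helm_vertex h r r"]) simp
  qed blast
  then show ?thesis
    using chromatic_number_le_iff[OF simple_graph_wheel(1)[OF assms]] vertex_labels_wheel[OF assms]
    by (simp add: verts_wheel)
qed

text \<open>No edge or path of length two contains two leaves, so leaf labels can be chosen
  independently, one rim vertex at a time.\<close>

definition helm_labels :: "nat \<Rightarrow> nat \<Rightarrow> nat \<Rightarrow> (nat \<Rightarrow> nat) \<Rightarrow> bool" where
  "helm_labels m k h r \<longleftrightarrow> wheel_labels m k h r \<and>
     (\<forall>i<m. \<exists>l\<in>{1..k}. leaf_label h (r (prv m i)) (r i) (r (nxt m i)) l)"

lemma chromatic_number_helm_le_iff:
  assumes "n \<ge> 4"
  shows "\<chi>td (helm n) \<le> k \<longleftrightarrow> (\<exists>h r. helm_labels (n - 1) k h r)"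
proof -
  let ?m = "n - 1"
  have "(\<exists>g. wheel_labels ?m k (g Hub) (\<lambda>i. g (Rim i)) \<and>
      (\<forall>i<?m. g (Leaf i) \<in> {1..k} \<and>
        leaf_label (g Hub) (g (Rim (prv ?m i))) (g (Rim i)) (g (Rim (nxt ?m i))) (g (Leaf i))))
    \<longleftrightarrow> (\<exists>h r. helm_labels ?m k h r)" (is "?A \<longleftrightarrow> ?B")
  proof
    assume ?B
    then obtain h r where r: "wheel_labels ?m k h r"
      and "\<forall>i<?m. \<exists>l. l \<in> {1..k} \<and> leaf_label h (r (prv ?m i)) (r i) (r (nxt ?m i)) l"
      unfolding helm_labels_def by blast
    then obtain l where "\<forall>i<?m. l i \<in> {1..k} \<and> leaf_label h (r (prv ?m i)) (r i) (r (nxt ?m i)) (l i)"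
      by metis
    with r show ?A by (intro exI[of _ "case_helm_vertex h r l"]) simp
  next
    assume ?A
    then show ?B unfolding helm_labels_def by blast
  qed
  then show ?thesis
    using chromatic_number_le_iff[OF simple_graph_helm[OF assms]] vertex_labels_helm[OF assms]
      vertex_labels_wheel[OF assms]
    by (simp add: verts_wheel verts_helm)
qed

section \<open>Counting: large orders\<close>

lemma leaf_label_exists:
  assumes "k \<ge> 10"
  shows "\<exists>l\<in>{1..k}. leaf_label h a b c l"
proof -
  \<comment> \<open>Truncated subtraction and rounding in \<open>b div 2\<close> may forbid a value
    needlessly, which is harmless: only avoiding \<open>?F\<close> has to imply
    \<open>leaf_label\<close>.\<close>
  let ?F = "set [b, 2 * b, b div 2, a, 2 * b - a, c, 2 * b - c, h, 2 * b - h]"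
  have "card ?F \<le> 9" by (rule order.trans[OF card_length]) simp
  then have "\<not> {1..k} \<subseteq> ?F"
    using assms card_mono[of ?F "{1..k}"] by auto
  then obtain l where l: "l \<in> {1..k}" "l \<notin> ?F" by blast
  then have "l \<noteq> b div 2" "l \<noteq> 2 * b - a" "l \<noteq> 2 * b - c" "l \<noteq> 2 * b - h" by simp_all
  then have "b \<noteq> 2 * l" "l + a \<noteq> 2 * b" "l + c \<noteq> 2 * b" "l + h \<noteq> 2 * b" by linarith+
  then show ?thesis using l unfolding leaf_label_def by (intro bexI[of _ l]) simp_all
qed

lemma wheel_labels_range:
  assumes "wheel_labels m k h r"
  shows "h \<in> {1..k}" "insert h (r ` {..<m}) \<subseteq> {1..k}" "card (insert h (r ` {..<m})) = Suc m"
proof -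
  show "h \<in> {1..k}" using assms unfolding wheel_labels_def by blast
  have "\<forall>i<m. r i \<in> {1..k}" "\<forall>i<m. r i \<noteq> h" "\<forall>i<m. \<forall>j<m. i \<noteq> j \<longrightarrow> r i \<noteq> r j"
    using assms unfolding wheel_labels_def by blast+
  then have "inj_on r {..<m}" "h \<notin> r ` {..<m}" "r ` {..<m} \<subseteq> {1..k}"
    unfolding inj_on_def by blast+
  then show "insert h (r ` {..<m}) \<subseteq> {1..k}" "card (insert h (r ` {..<m})) = Suc m"
    using \<open>h \<in> {1..k}\<close> by (simp_all add: card_image)
qed

lemma wheel_labels_ge:
  assumes "wheel_labels m k h r"
  shows "m < k"
  using card_mono[OF _ wheel_labels_range(2)[OF assms]] wheel_labels_range(3)[OF assms] by simp

lemma chromatic_number_wheel_ge: "n \<ge> 4 \<Longrightarrow> n \<le> \<chi>td (wheel n)"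
  using chromatic_number_wheel_le_iff[of n "\<chi>td (wheel n)"] wheel_labels_ge[of "n - 1"] by fastforce

lemma chromatic_number_wheel_le_helm: "n \<ge> 4 \<Longrightarrow> \<chi>td (wheel n) \<le> \<chi>td (helm n)"
  using chromatic_number_wheel_le_iff chromatic_number_helm_le_iff[of n "\<chi>td (helm n)"]
  unfolding helm_labels_def by auto

lemma chromatic_number_helm_eq_wheel:
  assumes "n \<ge> 10"
  shows "\<chi>td (helm n) = \<chi>td (wheel n)"
proof (rule antisym)
  have "10 \<le> \<chi>td (wheel n)" using chromatic_number_wheel_ge[of n] assms by simp
  then have "\<exists>h r. helm_labels (n - 1) (\<chi>td (wheel n)) h r"
    using chromatic_number_wheel_le_iff[of n "\<chi>td (wheel n)"] assms leaf_label_exists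
    unfolding helm_labels_def by auto
  then show "\<chi>td (helm n) \<le> \<chi>td (wheel n)"
    using chromatic_number_helm_le_iff assms by auto
qed (use chromatic_number_wheel_le_helm assms in simp)

section \<open>Exhaustive search over rim labelings\<close>

text \<open>The search runs over paths in the rim; the conditions \<open>a + c \<noteq> 2 * b\<close> and those on the edge
  that closes the cycle prune too little to be worth testing before the path is complete.\<close>

definition ext_ok :: "nat \<Rightarrow> nat \<Rightarrow> nat list \<Rightarrow> bool" where
  "ext_ok h x rs \<longleftrightarrow> x \<noteq> h \<and> x \<noteq> 2 * h \<and> h \<noteq> 2 * x \<and> (\<forall>y\<in>set rs. x \<noteq> y \<and> x + y \<noteq> 2 * h) \<and>
     (case rs of [] \<Rightarrow> True | y # _ \<Rightarrow> step_ok h x y)"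

primrec rims :: "nat \<Rightarrow> nat \<Rightarrow> nat \<Rightarrow> nat list list" where
  "rims k h 0 = [[]]"
| "rims k h (Suc j) =
     concat (map (\<lambda>rs. map (\<lambda>x. x # rs) (filter (\<lambda>x. ext_ok h x rs) [1..<Suc k])) (rims k h j))"

text \<open>Lists grow at the front, so the segment starting at \<open>i\<close> extends the one
  starting at \<open>Suc i\<close>; hence the start varies in the induction.\<close>

lemma wheel_labels_rims:
  assumes "wheel_labels m k h r" "i + j \<le> m"
  shows "map r [i..<i + j] \<in> set (rims k h j)"
  using assms(2)
proof (induction j arbitrary: i)
  case (Suc j)
  let ?rs = "map r [Suc i..<Suc i + j]"
  have "?rs \<in> set (rims k h j)" using Suc.IH[of "Suc i"] Suc.prems by simp
  \<comment> \<open>For \<open>j > 0\<close> the segment continues beyond \<open>i\<close>, and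
    \<open>i + Suc j \<le> m\<close> rules out wrapping around.\<close>
  moreover have "step_ok h (r i) (r (Suc i))" if "j > 0"
  proof -
    have "i < m" "nxt m i = Suc i" using that Suc.prems by (auto simp: nxt_eq)
    then show ?thesis using assms(1) unfolding wheel_labels_def by metis
  qed
  then have "ext_ok h (r i) ?rs" "r i \<in> {1..k}"
    using assms(1) Suc.prems
    by (cases j; auto simp: ext_ok_def wheel_labels_def upt_conv_Cons simp del: upt_Suc)+
  ultimately have "r i # ?rs \<in> set (rims k h (Suc j))"
    by (auto simp del: upt_Suc intro!: bexI[of _ ?rs])
  then show ?case by (simp add: upt_conv_Cons del: upt_Suc rims.simps)
qed simp

text \<open>\<open>nxt\<close> and \<open>prv\<close> stay below \<open>m\<close>, so a rim function
  can be traded for list lookup, which makes the conditions executable.\<close>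

lemma wheel_labels_cong:
  "(\<And>i. i < m \<Longrightarrow> r i = s i) \<Longrightarrow> wheel_labels m k h r = wheel_labels m k h s"
  unfolding wheel_labels_def by simp

lemma helm_labels_cong:
  "(\<And>i. i < m \<Longrightarrow> r i = s i) \<Longrightarrow> helm_labels m k h r = helm_labels m k h s"
  unfolding helm_labels_def using wheel_labels_cong[of m r s] by simp

text \<open>Completeness of the search: if the filtered list is empty for every hub label, no
  labeling exists.\<close>

lemma wheel_labels_search:
  assumes "wheel_labels m k h r"
  shows "h \<in> set [1..<Suc k]"
    and "map r [0..<m] \<in> set (filter (\<lambda>rs. wheel_labels m k h ((!) rs)) (rims k h m))"
proof -
  show "h \<in> set [1..<Suc k]" using assms by (auto dest: wheel_labels_range(1))
  have "wheel_labels m k h ((!) (map r [0..<m]))"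
    using assms by (subst wheel_labels_cong[of m _ r]) auto
  then show "map r [0..<m] \<in> set (filter (\<lambda>rs. wheel_labels m k h ((!) rs)) (rims k h m))"
    using wheel_labels_rims[OF assms, of 0 m] by simp
qed

lemma helm_labels_search:
  assumes "helm_labels m k h r"
  shows "\<exists>rs\<in>set (filter (\<lambda>rs. wheel_labels m k h ((!) rs)) (rims k h m)). helm_labels m k h ((!) rs)"
proof (rule bexI)
  show "helm_labels m k h ((!) (map r [0..<m]))"
    using assms by (subst helm_labels_cong[of m _ r]) auto
  show "map r [0..<m] \<in> set (filter (\<lambda>rs. wheel_labels m k h ((!) rs)) (rims k h m))"
    using assms wheel_labels_search(2) unfolding helm_labels_def by blast
qed

section \<open>Small orders: lower bounds and explicit labelings\<close>

text \<open>With \<open>m + 1\<close> distinct labels in \<open>1, ..., m + 1\<close>, every value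
  occurs. If \<open>h = 1\<close>, its double 2 is on the rim; if \<open>h\<close> is strictly
  inside the range, the rim labels \<open>h - 1\<close> and \<open>h + 1\<close> sum to
  \<open>2 * h\<close>. So \<open>h = m + 1\<close>, and an even \<open>h\<close> would have its
  half on the rim.\<close>

lemma wheel_labels_Suc:
  assumes W: "wheel_labels m (Suc m) h r" and m: "m > 0"
  shows "h = Suc m \<and> even m"
proof -
  have "insert h (r ` {..<m}) = {1..Suc m}"
    using wheel_labels_range[OF W] by (intro card_subset_eq) simp_all
  then have R: "x \<in> r ` {..<m}" if "x \<in> {1..Suc m}" "x \<noteq> h" for x
    using that by blast
  have P: "x + y \<noteq> 2 * h" if "x \<in> r ` {..<m}" "y \<in> r ` {..<m}" "x \<noteq> y" for x y
    using W that unfolding wheel_labels_def by blast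
  have D: "x \<noteq> 2 * h" "h \<noteq> 2 * x" if "x \<in> r ` {..<m}" for x
  proof -
    have "\<forall>i<m. r i \<noteq> 2 * h \<and> h \<noteq> 2 * r i" using W by (simp add: wheel_labels_def)
    then show "x \<noteq> 2 * h" "h \<noteq> 2 * x" using that by auto
  qed
  consider "h = 1" | "h = Suc m" | "h - 1 \<in> {1..Suc m}" "h + 1 \<in> {1..Suc m}"
    using wheel_labels_range(1)[OF W] by fastforce
  then show ?thesis
  proof cases
    case 1
    then show ?thesis using R[of 2] D(1)[of 2] m by simp
  next
    case 2
    have "\<not> odd m"
    proof
      assume "odd m"
      then obtain x where "Suc m = 2 * x" by (meson even_Suc evenE)
      then show False using 2 R[of x] D(2)[of x] m by simp
    qed
    then show ?thesis using 2 by simp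
  next
    case 3
    then have "(h - 1) + (h + 1) \<noteq> 2 * h" by (intro P R) auto
    then show ?thesis using 3 by auto
  qed
qed

text \<open>Lower bounds for the wheels of orders 4, 5 and 8. The last is the tight case with an odd
  rim, so parity replaces the search.\<close>

lemma no_wheel_labels:
  "\<not> wheel_labels 3 7 h r" "\<not> wheel_labels 4 6 h r" "\<not> wheel_labels 7 8 h r"
proof -
  have "\<forall>h\<in>set [1..<Suc 7]. filter (\<lambda>rs. wheel_labels 3 7 h ((!) rs)) (rims 7 h 3) = []"
    by code_simp
  then show "\<not> wheel_labels 3 7 h r"
    using wheel_labels_search[of 3 7 h r] by (metis empty_iff empty_set)
  have "\<forall>h\<in>set [1..<Suc 6]. filter (\<lambda>rs. wheel_labels 4 6 h ((!) rs)) (rims 6 h 4) = []"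
    by code_simp
  then show "\<not> wheel_labels 4 6 h r"
    using wheel_labels_search[of 4 6 h r] by (metis empty_iff empty_set)
  show "\<not> wheel_labels 7 8 h r" using wheel_labels_Suc[of 7] by auto
qed

lemma no_helm_labels:
  "\<not> helm_labels 5 7 h r" "\<not> helm_labels 6 7 h r"
proof -
  have "\<forall>h\<in>set [1..<Suc 7]. \<forall>rs\<in>set (filter (\<lambda>rs. wheel_labels 5 7 h ((!) rs)) (rims 7 h 5)).
      \<not> helm_labels 5 7 h ((!) rs)"
    by code_simp
  then show "\<not> helm_labels 5 7 h r"
    using helm_labels_search wheel_labels_search(1) unfolding helm_labels_def by blast
  \<comment> \<open>Here \<open>k = m + 1\<close>, so the hub label must be 7 and one hub value is
    searched.\<close>
  have "\<forall>rs\<in>set (filter (\<lambda>rs. wheel_labels 6 7 7 ((!) rs)) (rims 7 7 6)).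
      \<not> helm_labels 6 7 7 ((!) rs)"
    by code_simp
  then have "\<not> helm_labels 6 7 7 r" using helm_labels_search by blast
  moreover have "h = 7" if "helm_labels 6 7 h r"
    using that wheel_labels_Suc[of 6 h r] by (simp add: helm_labels_def)
  ultimately show "\<not> helm_labels 6 7 h r" by blast
qed

text \<open>The wheels of orders 6 and 7 need at most 7 labels, while their helms need more than 7:
  this separates the exceptional cases.\<close>

lemma wheel_labels_examples:
  "wheel_labels 5 7 1 ((!) [3, 4, 6, 5, 7])"
  "wheel_labels 6 7 7 ((!) [1, 3, 2, 5, 4, 6])"
  by code_simp+

text \<open>Only hub and rim are listed; evaluation finds the leaf labels.\<close>

lemma helm_labels_examples:
  "helm_labels 3 8 1 ((!) [3, 7, 8])"
  "helm_labels 4 7 5 ((!) [1, 6, 2, 7])"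
  "helm_labels 5 8 1 ((!) [3, 7, 5, 6, 8])"
  "helm_labels 6 8 8 ((!) [1, 3, 2, 6, 5, 7])"
  "helm_labels 7 9 1 ((!) [3, 4, 6, 5, 8, 7, 9])"
  "helm_labels 8 9 9 ((!) [1, 3, 2, 5, 4, 7, 6, 8])"
  by code_simp+

theorem theorem5p3:
  shows "(\<forall>n::nat. n \<ge> 4 \<and> n \<notin> {6, 7} \<longrightarrow> \<chi>td (helm n) = \<chi>td (wheel n)) \<and>
    \<chi>td (helm 6) = 8 \<and> \<chi>td (helm 7) = 8 \<and>
    (\<forall>n \<in> {6, 7::nat}. \<chi>td (helm n) \<noteq> \<chi>td (wheel n))"
proof -
  note W = chromatic_number_wheel_le_iff and H = chromatic_number_helm_le_iff
  have upper: "\<chi>td (helm 4) \<le> 8" "\<chi>td (helm 5) \<le> 7" "\<chi>td (helm 6) \<le> 8" "\<chi>td (helm 7) \<le> 8"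
    "\<chi>td (helm 8) \<le> 9" "\<chi>td (helm 9) \<le> 9" "\<chi>td (wheel 6) \<le> 7" "\<chi>td (wheel 7) \<le> 7"
    using helm_labels_examples wheel_labels_examples by (auto simp: W H)
  have "\<not> \<chi>td (wheel 4) \<le> 7" "\<not> \<chi>td (wheel 5) \<le> 6" "\<not> \<chi>td (wheel 8) \<le> 8"
    "\<not> \<chi>td (helm 6) \<le> 7" "\<not> \<chi>td (helm 7) \<le> 7"
    using no_wheel_labels no_helm_labels by (auto simp: W H)
  moreover have "\<chi>td (helm n) = \<chi>td (wheel n)" if "n \<ge> 4" "n \<notin> {6, 7}" for n
  proof -
    \<comment> \<open>For orders 4, 5, 8, 9 the upper bounds 8, 7, 9, 9 for the helm meet the lower
      bounds for the wheel; at order 9 the latter is the general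
      \<open>n \<le> \<chi>td (wheel n)\<close>.\<close>
    consider "n = 4" | "n = 5" | "n = 8" | "n = 9" | "n \<ge> 10"
      using \<open>n \<ge> 4\<close> \<open>n \<notin> {6, 7}\<close> by fastforce
    then show ?thesis
    proof cases
      case 5
      then show ?thesis by (rule chromatic_number_helm_eq_wheel)
    qed (use calculation upper chromatic_number_wheel_le_helm[of n] chromatic_number_wheel_ge[of n]
        in auto)
  qed
  ultimately show ?thesis using upper by auto
qed

end
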